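(* Let $(A,\oplus)$ be a ccm-magma and let $e\in A$ be an idempotent element ($e\oplus e=e$). If $A$ is $e$-expansive then $(A,*_e,e)$ is a monoid with \[x*_e y=2_e(x\oplus y).\] Moreover, it is a group if and only if $A$ is $e$-symmetric.
   Context: A ccm-magma (commutative cancellative medial magma) is a set $A$ with a binary operation $\oplus$ such that for all $a,b,c,d\in A$: (M1) $a\oplus b=b\oplus a$; (M2) $a\oplus c=b\oplus c$ implies $a=b$; (M3) $(a\oplus b)\oplus(c\oplus d)=(a\oplus c)\oplus(b\oplus d)$. For $e\in A$: $A$ is $e$-expansive if for every $a\in A$ there exists an element (unique by cancellation) $2_e(a)\in A$ with $2_e(a)\oplus e=a$. $A$ is $e$-symmetric if for every $a\in A$ there exists an element $-_e(a)\in A$ with $-_e(a)\oplus a=e$. *)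

theory Defs
  imports "HOL-Algebra.Group"
begin

locale ccm_magma =
  fixes A :: "'a set" and add :: "'a \<Rightarrow> 'a \<Rightarrow> 'a" (infixl "\<oplus>" 65)
  assumes add_closed: "\<lbrakk>a \<in> A; b \<in> A\<rbrakk> \<Longrightarrow> a \<oplus> b \<in> A"
    and commutative: "\<lbrakk>a \<in> A; b \<in> A\<rbrakk> \<Longrightarrow> a \<oplus> b = b \<oplus> a"
    and cancellative: "\<lbrakk>a \<in> A; b \<in> A; c \<in> A; a \<oplus> c = b \<oplus> c\<rbrakk> \<Longrightarrow> a = b"
    and medial: "\<lbrakk>a \<in> A; b \<in> A; c \<in> A; d \<in> A\<rbrakk> \<Longrightarrow>
      (a \<oplus> b) \<oplus> (c \<oplus> d) = (a \<oplus> c) \<oplus> (b \<oplus> d)"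

definition expansive :: "'a set \<Rightarrow> ('a \<Rightarrow> 'a \<Rightarrow> 'a) \<Rightarrow> 'a \<Rightarrow> bool" where
  "expansive A add e \<longleftrightarrow> (\<forall>a\<in>A. \<exists>b\<in>A. add b e = a)"

definition symmetric :: "'a set \<Rightarrow> ('a \<Rightarrow> 'a \<Rightarrow> 'a) \<Rightarrow> 'a \<Rightarrow> bool" where
  "symmetric A add e \<longleftrightarrow> (\<forall>a\<in>A. \<exists>b\<in>A. add b a = e)"

text \<open>The element \<open>2\<^sub>e(a)\<close>. The description is meaningful for \<open>a \<in> A\<close> when \<open>A\<close> is an
  \<open>e\<close>-expansive ccm-magma (lemma \<open>double_welldefined\<close>).\<close>

definition double :: "'a set \<Rightarrow> ('a \<Rightarrow> 'a \<Rightarrow> 'a) \<Rightarrow> 'a \<Rightarrow> 'a \<Rightarrow> 'a" where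
  "double A add e a = (THE b. b \<in> A \<and> add b e = a)"

definition star_monoid :: "'a set \<Rightarrow> ('a \<Rightarrow> 'a \<Rightarrow> 'a) \<Rightarrow> 'a \<Rightarrow> 'a monoid" where
  "star_monoid A add e = \<lparr>carrier = A, mult = (\<lambda>x y. double A add e (add x y)), one = e\<rparr>"

lemma double_welldefined:
  assumes "ccm_magma A add" "e \<in> A" "expansive A add e" "a \<in> A"
  shows "\<exists>!b. b \<in> A \<and> add b e = a"
    and "double A add e a \<in> A" and "add (double A add e a) e = a"
proof -
  interpret ccm_magma A add by fact
  show ex1: "\<exists>!b. b \<in> A \<and> add b e = a"
    using assms(2-4) cancellative unfolding expansive_def by blast
  show "double A add e a \<in> A" and "add (double A add e a) e = a"
    using theI'[OF ex1] by (simp_all add: double_def)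
qed

end

theory Submission
  imports Defs
begin

text \<open>
  By cancellation, adding \<open>e\<close> on the right is injective, and \<open>e\<close>-expansivity says that it is
  surjective; the product \<open>x * y\<close> is therefore the unique solution of \<open>(x * y) \<oplus> e = x \<oplus> y\<close>
  (lemma \<open>double_eq_iff\<close>). Every claim about \<open>*\<close> becomes a claim about \<open>\<oplus>\<close> once \<open>e\<close> is
  added often enough. The unit law becomes commutativity. For associativity
  \<open>e\<close> is added twice: idempotence lets the second summand be written as \<open>e \<oplus> e\<close>, the
  medial law then distributes it over the two factors, and both bracketings become
  \<open>(x \<oplus> y) \<oplus> (e \<oplus> z) = (x \<oplus> e) \<oplus> (y \<oplus> z)\<close>, again an instance of the medial law. Finally,
  \<open>y * x = e\<close> is equivalent to \<open>y \<oplus> x = e \<oplus> e = e\<close>, so inverses for \<open>*\<close> are exactly the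
  elements required by \<open>e\<close>-symmetry.
\<close>

context ccm_magma
begin

text \<open>This characterization replaces the definite description in all later arguments.\<close>

lemma double_eq_iff:
  assumes "e \<in> A" "expansive A (\<oplus>) e" "a \<in> A" "b \<in> A"
  shows "double A (\<oplus>) e a = b \<longleftrightarrow> b \<oplus> e = a"
  using double_welldefined(3)[OF ccm_magma_axioms assms(1-3)]
    cancellative[OF double_welldefined(2)[OF ccm_magma_axioms assms(1-3)] assms(4) assms(1)]
  by auto

text \<open>Adding \<open>e\<close> to \<open>2\<^sub>e(a) \<oplus> c\<close> cancels the doubling at the cost of an \<open>e\<close> next to \<open>c\<close>:
  this is how a nested product is unfolded.\<close>

lemma double_add_add_idempotent:
  assumes "e \<in> A" "e \<oplus> e = e" "expansive A (\<oplus>) e" "a \<in> A" "c \<in> A"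
  shows "(double A (\<oplus>) e a \<oplus> c) \<oplus> e = a \<oplus> (c \<oplus> e)"
proof -
  note d = double_welldefined[OF ccm_magma_axioms assms(1,3,4)]
  have "(double A (\<oplus>) e a \<oplus> c) \<oplus> (e \<oplus> e) = (double A (\<oplus>) e a \<oplus> e) \<oplus> (c \<oplus> e)"
    by (rule medial[OF d(2) assms(5,1,1)])
  then show ?thesis
    using d(3) assms(2) by simp
qed

lemma double_assoc:
  assumes e: "e \<in> A" "e \<oplus> e = e" and ex: "expansive A (\<oplus>) e"
    and xyz: "x \<in> A" "y \<in> A" "z \<in> A"
  shows "double A (\<oplus>) e (double A (\<oplus>) e (x \<oplus> y) \<oplus> z)
       = double A (\<oplus>) e (x \<oplus> double A (\<oplus>) e (y \<oplus> z))"
proof -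
  have dA: "double A (\<oplus>) e (a \<oplus> b) \<in> A" if "a \<in> A" "b \<in> A" for a b
    by (rule double_welldefined(2)[OF ccm_magma_axioms e(1) ex add_closed[OF that]])
  have "(double A (\<oplus>) e (x \<oplus> y) \<oplus> z) \<oplus> e = (x \<oplus> y) \<oplus> (z \<oplus> e)"
    by (rule double_add_add_idempotent[OF e ex add_closed[OF xyz(1,2)] xyz(3)])
  also have "\<dots> = (x \<oplus> y) \<oplus> (e \<oplus> z)"
    by (simp only: commutative[OF xyz(3) e(1)])
  also have "\<dots> = (x \<oplus> e) \<oplus> (y \<oplus> z)"
    by (rule medial[OF xyz(1,2) e(1) xyz(3)])
  also have "\<dots> = (y \<oplus> z) \<oplus> (x \<oplus> e)"
    by (rule commutative[OF add_closed[OF xyz(1) e(1)] add_closed[OF xyz(2,3)]])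
  also have "\<dots> = (double A (\<oplus>) e (y \<oplus> z) \<oplus> x) \<oplus> e"
    by (rule double_add_add_idempotent[OF e ex add_closed[OF xyz(2,3)] xyz(1), symmetric])
  also have "\<dots> = (x \<oplus> double A (\<oplus>) e (y \<oplus> z)) \<oplus> e"
    by (simp only: commutative[OF dA[OF xyz(2,3)] xyz(1)])
  finally have "double A (\<oplus>) e (x \<oplus> y) \<oplus> z = x \<oplus> double A (\<oplus>) e (y \<oplus> z)"
    by (rule cancellative[OF add_closed[OF dA[OF xyz(1,2)] xyz(3)]
          add_closed[OF xyz(1) dA[OF xyz(2,3)]] e(1)])
  then show ?thesis by simp
qed

lemma monoid_star_monoid:
  assumes e: "e \<in> A" "e \<oplus> e = e" and ex: "expansive A (\<oplus>) e"
  shows "monoid (star_monoid A (\<oplus>) e)"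
proof (rule monoidI, unfold star_monoid_def, simp_all only: monoid.simps partial_object.simps)
  fix x y assume "x \<in> A" "y \<in> A"
  then show "double A (\<oplus>) e (x \<oplus> y) \<in> A"
    by (intro double_welldefined(2)[OF ccm_magma_axioms e(1) ex] add_closed)
next
  show "e \<in> A" by (rule e)
next
  fix x y z assume "x \<in> A" "y \<in> A" "z \<in> A"
  then show "double A (\<oplus>) e (double A (\<oplus>) e (x \<oplus> y) \<oplus> z)
           = double A (\<oplus>) e (x \<oplus> double A (\<oplus>) e (y \<oplus> z))"
    by (rule double_assoc[OF e ex])
next
  fix x assume "x \<in> A"
  then show "double A (\<oplus>) e (e \<oplus> x) = x" "double A (\<oplus>) e (x \<oplus> e) = x"
    using double_eq_iff[OF e(1) ex add_closed[OF _ e(1)], of x x] commutative[OF e(1), of x]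
    by simp_all
qed

lemma star_eq_idempotent_iff:
  assumes "e \<in> A" "e \<oplus> e = e" "expansive A (\<oplus>) e" "x \<in> A" "y \<in> A"
  shows "double A (\<oplus>) e (y \<oplus> x) = e \<longleftrightarrow> y \<oplus> x = e"
  using double_eq_iff[OF assms(1,3) add_closed[OF assms(5,4)] assms(1)] assms(2) by auto

lemma group_star_monoid_iff:
  assumes e: "e \<in> A" "e \<oplus> e = e" and ex: "expansive A (\<oplus>) e"
  shows "group (star_monoid A (\<oplus>) e) \<longleftrightarrow> symmetric A (\<oplus>) e"
proof -
  interpret S: monoid "star_monoid A (\<oplus>) e"
    using monoid_star_monoid[OF e ex] .
  have "group (star_monoid A (\<oplus>) e) \<longleftrightarrow>
      (\<forall>x\<in>A. \<exists>y\<in>A. double A (\<oplus>) e (y \<oplus> x) = e)"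
  proof
    assume "group (star_monoid A (\<oplus>) e)"
    then show "\<forall>x\<in>A. \<exists>y\<in>A. double A (\<oplus>) e (y \<oplus> x) = e"
      using group.l_inv_ex[of "star_monoid A (\<oplus>) e"] by (simp add: star_monoid_def)
  next
    assume "\<forall>x\<in>A. \<exists>y\<in>A. double A (\<oplus>) e (y \<oplus> x) = e"
    then show "group (star_monoid A (\<oplus>) e)"
      by (intro S.group_l_invI) (simp add: star_monoid_def)
  qed
  then show ?thesis
    using star_eq_idempotent_iff[OF e ex] by (simp add: symmetric_def)
qed

end

theorem proposition5p2:
  fixes A :: "'a set" and add :: "'a \<Rightarrow> 'a \<Rightarrow> 'a" and e :: 'a
  assumes "ccm_magma A add"
    and "e \<in> A"
    and "add e e = e"
    and "expansive A add e"
  shows "monoid (star_monoid A add e) \<and>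
    (group (star_monoid A add e) \<longleftrightarrow> symmetric A add e)"
  using ccm_magma.monoid_star_monoid[OF assms] ccm_magma.group_star_monoid_iff[OF assms] ..

end
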